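(* Let $f(\mathbf u)=\sum_{n=1}^N g_n(\mathbf u)$, where $g_n$ satisfies (F1)–(F4) for all $n\in\{1,\dots,N\}$. Let $\mathbf a\in\mathbb R^N$, where $\mathbf a\succeq\mathbf 1$, and let $f_s(\mathbf u)=\sum_{n=1}^N a_n g_n(\mathbf u)$. Consider a discretization of the set $\{\mathbf u:\mathbf 0\preceq\mathbf u\preceq (T-1)\mathbf 1\}$ and denote the points in this discretized set by $\mathcal U$. Then the problem $$\underset{\mathbf a\succeq\mathbf 1}{\text{minimize}}\ \max_{\mathbf u\in\mathcal U}\ \frac{f^*(\nabla f_s(\mathbf u+\mathbf 1))}{f_s(\mathbf u)-f(\mathbf u)}$$ can be solved as a quasiconvex optimization problem.
   Context: $D,N,T$ are positive integers; $\succeq,\preceq$ are componentwise inequalities, and $\mathbf 0,\mathbf 1$ are the all-zeros and all-ones vectors of the appropriate dimension. A function $g:\mathbb R_+^D\to\mathbb R_+$ satisfies: (F1) if $g$ is convex, differentiable and closed (all its sublevel sets are closed); (F2) if $g$ is increasing, i.e. $\mathbf u\succeq\mathbf v$ implies $g(\mathbf u)\ge g(\mathbf v)$; (F3) if $g$ has an increasing gradient, i.e. $\mathbf u\succeq\mathbf v$ implies $\nabla g(\mathbf u)\succeq\nabla g(\mathbf v)$; (F4) if $g(\mathbf 0)=0$. The convex conjugate of $f$ is $f^*(\mathbf v)=\sup_{\mathbf u}\{\mathbf v^\top\mathbf u-f(\mathbf u)\}$, the supremum being over the domain of $f$. A function is quasiconvex if its domain is convex and, for each $\alpha\in\mathbb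 R$, its $\alpha$-sublevel set is convex. A quasiconvex optimization problem is the minimization of a quasiconvex objective subject to convex constraints; here the optimization variable is $\mathbf a$. *)

theory Defs
  imports "HOL-Analysis.Analysis"
begin

text \<open>
  Vectors in \<open>real ^ 'd\<close> carry the componentwise order; \<open>0\<close> and \<open>1\<close> are the all-zeros and
  all-ones vectors.
\<close>

definition orthant :: "(real ^ 'd) set" where
  "orthant = {u. 0 \<le> u}"

text \<open>
  The functions \<open>g\<close> below live on the nonnegative orthant only; their values elsewhere are
  irrelevant. Differentiability and the gradient are therefore taken within the orthant. The
  gradient is unique also at boundary points, and at points with positive coordinates (such as
  \<open>u + 1\<close> with \<open>u\<close> in the orthant) it is the usual one.
\<close>

definition grad :: "(real ^ 'd \<Rightarrow> real) \<Rightarrow> real ^ 'd \<Rightarrow> real ^ 'd" where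
  "grad g u = (THE v. (g has_derivative (\<lambda>h. v \<bullet> h)) (at u within orthant))"

definition F1 :: "(real ^ 'd \<Rightarrow> real) \<Rightarrow> bool" where
  "F1 g \<longleftrightarrow> convex_on orthant g \<and> g differentiable_on orthant \<and>
     (\<forall>\<alpha>. closed {u \<in> orthant. g u \<le> \<alpha>})"

definition F2 :: "(real ^ 'd \<Rightarrow> real) \<Rightarrow> bool" where
  "F2 g \<longleftrightarrow> (\<forall>u\<in>orthant. \<forall>v\<in>orthant. v \<le> u \<longrightarrow> g v \<le> g u)"

definition F3 :: "(real ^ 'd \<Rightarrow> real) \<Rightarrow> bool" where
  "F3 g \<longleftrightarrow> (\<forall>u\<in>orthant. \<forall>v\<in>orthant. v \<le> u \<longrightarrow> grad g v \<le> grad g u)"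

definition F4 :: "(real ^ 'd \<Rightarrow> real) \<Rightarrow> bool" where
  "F4 g \<longleftrightarrow> g 0 = 0"

definition conjugate :: "(real ^ 'd \<Rightarrow> real) \<Rightarrow> real ^ 'd \<Rightarrow> ereal" where
  "conjugate f v = (SUP u\<in>orthant. ereal (v \<bullet> u - f u))"

definition wsum :: "('n::finite \<Rightarrow> real ^ 'd \<Rightarrow> real) \<Rightarrow> real ^ 'n \<Rightarrow> real ^ 'd \<Rightarrow> real" where
  "wsum g a u = (\<Sum>n\<in>UNIV. a $ n * g n u)"

text \<open>
  Extended-real quotient: a positive number divided by \<open>0\<close> is \<open>\<infinity>\<close>, as in the library. The
  value \<open>z\<close> of \<open>0 / 0\<close> is left as a parameter (the library would fix it to be \<open>0\<close>);
  \<open>z = \<infinity>\<close> excludes such points from the domain of the quotient, while \<open>z = 0\<close> makes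
  \<open>p / q \<le> \<alpha>\<close> mean \<open>p \<le> \<alpha> * q\<close> for all \<open>p, q, \<alpha> \<ge> 0\<close> with \<open>q\<close> and \<open>\<alpha>\<close> finite.
\<close>

definition quot :: "ereal \<Rightarrow> ereal \<Rightarrow> ereal \<Rightarrow> ereal" where
  "quot z p q = (if p = 0 \<and> q = 0 then z else p / q)"

definition objective ::
  "ereal \<Rightarrow> ('n::finite \<Rightarrow> real ^ 'd \<Rightarrow> real) \<Rightarrow> (real ^ 'd) set \<Rightarrow> real ^ 'n \<Rightarrow> ereal" where
  "objective z g U a =
     (let f = (\<lambda>u. \<Sum>n\<in>UNIV. g n u); fs = wsum g a in
      (MAX u\<in>U. quot z (conjugate f (grad fs (u + 1))) (ereal (fs u - f u))))"

text \<open>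
  For an extended-real-valued \<open>F\<close>, its domain within \<open>S\<close> consists of the points of \<open>S\<close> where
  \<open>F\<close> is less than \<open>\<infinity>\<close>.
\<close>

definition quasiconvex_on :: "'a::real_vector set \<Rightarrow> ('a \<Rightarrow> ereal) \<Rightarrow> bool" where
  "quasiconvex_on S F \<longleftrightarrow> convex {x \<in> S. F x < \<infinity>} \<and>
     (\<forall>\<alpha>::real. convex {x \<in> S. F x \<le> ereal \<alpha>})"

text \<open>
  The problem of minimizing \<open>F\<close> over \<open>C\<close>, where \<open>C\<close> is cut out by finitely many convex
  inequality constraints \<open>h x \<le> 0\<close>.
\<close>

definition quasiconvex_problem :: "'a::real_vector set \<Rightarrow> ('a \<Rightarrow> ereal) \<Rightarrow> bool" where
  "quasiconvex_problem C F \<longleftrightarrow> quasiconvex_on C F \<and>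
     (\<exists>H. finite H \<and> (\<forall>h\<in>H. convex_on UNIV h) \<and> C = {x. \<forall>h\<in>H. h x \<le> (0::real)})"

end

theory Submission
  imports Defs
begin

text \<open>
  Fix a point \<open>u\<close> of the grid. The gradient of the weighted sum at \<open>u + 1\<close> depends linearly on the
  weights \<open>a\<close> (lemma \<open>grad_wsum\<close>), and the conjugate is a supremum of affine functions, so the
  numerator is a supremum of affine functions of \<open>a\<close>. The denominator is affine in \<open>a\<close>. On the
  feasible set it is nonnegative, and the numerator is nonnegative because \<open>f 0 = 0\<close>. Hence
  ``ratio at most \<open>\<alpha>\<close>'' can be cleared of its denominator (lemma \<open>quot_le_iff\<close>): the numerator is at
  most \<open>\<alpha>\<close> times the denominator, which is an intersection of half-spaces in \<open>a\<close>.

  Points where both vanish need care. If the value \<open>z\<close> of \<open>0 / 0\<close> exceeds \<open>\<alpha>\<close> they have to be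
  removed, but removing them amounts to demanding that the denominator is positive, which is once
  more a half-space. Finally, the maximum over the grid intersects finitely many such convex sets,
  and the domain is the increasing union of the sublevel sets.
\<close>

section \<open>Gradients of weighted sums\<close>

text \<open>
  Shifting by \<open>1\<close> moves a point of the orthant into its interior, where derivatives within the
  orthant are ordinary derivatives and therefore unique.
\<close>

lemma orthant_shift_in_interior:
  fixes u :: "real ^ 'd"
  assumes "u \<in> orthant"
  shows "u + 1 \<in> interior orthant"
proof (rule interiorI)
  show "open {x :: real ^ 'd. \<forall>i. 0 < x $ i}"
    unfolding Collect_all_eq
    by (intro open_INT finite ballI open_Collect_less continuous_intros)
  show "u + 1 \<in> {x. \<forall>i. 0 < x $ i}"
    using assms by (auto simp: orthant_def less_eq_vec_def intro: add_nonneg_pos)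
  show "{x :: real ^ 'd. \<forall>i. 0 < x $ i} \<subseteq> orthant"
    by (auto simp: orthant_def less_eq_vec_def less_imp_le)
qed

lemma grad_eqI:
  fixes x :: "real ^ 'd"
  assumes "x \<in> interior orthant"
    and "(g has_derivative (\<lambda>h. v \<bullet> h)) (at x within orthant)"
  shows "grad g x = v"
  unfolding grad_def
proof (rule the_equality)
  fix w assume "(g has_derivative (\<lambda>h. w \<bullet> h)) (at x within orthant)"
  with assms have "(\<lambda>h. w \<bullet> h) = (\<lambda>h. v \<bullet> h)"
    by (metis at_within_interior has_derivative_unique)
  then show "w = v"
    by (metis vector_eq_rdot)
qed (use assms in simp)

lemma has_derivative_grad:
  fixes x :: "real ^ 'd"
  assumes "F1 g" and "x \<in> interior orthant"
  shows "(g has_derivative (\<lambda>h. grad g x \<bullet> h)) (at x within orthant)"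
proof -
  have "g differentiable (at x within orthant)"
    using assms interior_subset unfolding F1_def differentiable_on_def by blast
  then obtain D where D: "(g has_derivative D) (at x within orthant)"
    unfolding differentiable_def by blast
  then interpret D: bounded_linear D
    by (rule has_derivative_bounded_linear)
  \<comment> \<open>Every linear functional on Euclidean space is the inner product with the adjoint's value at \<open>1\<close>.\<close>
  have "D = (\<lambda>h. adjoint D 1 \<bullet> h)"
    using adjoint_works[OF D.linear_axioms, of _ 1] by (auto simp: inner_commute)
  with D have "(g has_derivative (\<lambda>h. adjoint D 1 \<bullet> h)) (at x within orthant)"
    by simp
  with grad_eqI[OF assms(2) this] show ?thesis
    by simp
qed

lemma grad_wsum:
  fixes g :: "'n::finite \<Rightarrow> real ^ 'd \<Rightarrow> real"
  assumes "\<And>n. F1 (g n)" and "x \<in> interior orthant"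
  shows "grad (wsum g a) x = (\<Sum>n\<in>UNIV. a $ n *\<^sub>R grad (g n) x)"
proof (rule grad_eqI)
  have "(wsum g a has_derivative (\<lambda>h. \<Sum>n\<in>UNIV. a $ n * (grad (g n) x \<bullet> h))) (at x within orthant)"
    unfolding wsum_def
    by (intro has_derivative_sum has_derivative_mult_right has_derivative_grad assms)
  then show "(wsum g a has_derivative (\<lambda>h. (\<Sum>n\<in>UNIV. a $ n *\<^sub>R grad (g n) x) \<bullet> h))
      (at x within orthant)"
    by (simp add: inner_sum_left)
qed (rule assms)

section \<open>Conjugates and quotients\<close>

lemma conjugate_nonneg:
  assumes "f 0 = 0"
  shows "0 \<le> conjugate f v"
proof -
  have "ereal (v \<bullet> 0 - f 0) \<le> conjugate f v"
    unfolding conjugate_def by (rule SUP_upper) (simp add: orthant_def)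
  with assms show ?thesis
    by (simp add: zero_ereal_def)
qed

text \<open>
  The second conjunct excludes \<open>0 / 0\<close> when its value is too large. Stating it as positivity of the
  denominator, instead of as \<open>\<not> (p = 0 \<and> q = 0)\<close>, is possible because the first conjunct forces
  \<open>p = 0\<close> when \<open>q = 0\<close>; both conjuncts thereby become convex conditions.
\<close>

lemma quot_le_iff:
  assumes "0 \<le> p" and "0 \<le> q" and "0 \<le> z"
  shows "quot z p (ereal q) \<le> ereal \<alpha> \<longleftrightarrow> p \<le> ereal (\<alpha> * q) \<and> (0 < q \<or> z \<le> ereal \<alpha>)"
proof (cases "q = 0")
  case True
  show ?thesis
  proof (cases "p = 0")
    case p: False
    then have "p / ereal q = \<infinity>"
      using assms(1) True by (cases p) (auto simp: divide_ereal_def)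
    then show ?thesis
      using p assms(1) True by (auto simp: quot_def zero_ereal_def[symmetric])
  qed (use True in \<open>simp add: quot_def zero_ereal_def[symmetric]\<close>)
next
  case False
  with assms(2) have "0 < q" by simp
  then show ?thesis
    using assms(1) by (cases p) (auto simp: quot_def zero_ereal_def[symmetric] pos_divide_le_eq)
qed

section \<open>Quasiconvexity\<close>

text \<open>
  Convexity of the domain comes for free: the domain is the union of the sublevel sets, and any two
  of its points lie in a common one.
\<close>

lemma quasiconvex_onI:
  assumes "\<And>\<alpha>::real. convex {x \<in> S. F x \<le> ereal \<alpha>}"
  shows "quasiconvex_on S F"
  unfolding quasiconvex_on_def
proof (intro conjI allI assms)
  show "convex {x \<in> S. F x < \<infinity>}"
  proof (rule convexI)
    fix x y and s t :: real
    assume xy: "x \<in> {x \<in> S. F x < \<infinity>}" "y \<in> {x \<in> S. F x < \<infinity>}"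
      and st: "0 \<le> s" "0 \<le> t" "s + t = 1"
    define m where "m = max (F x) (F y)"
    from xy have "m < \<infinity>" by (auto simp: m_def max_def)
    then obtain \<alpha> :: real where "m \<le> ereal \<alpha>"
      by (cases m) auto
    with xy have "x \<in> {x \<in> S. F x \<le> ereal \<alpha>}" "y \<in> {x \<in> S. F x \<le> ereal \<alpha>}"
      by (auto simp: m_def)
    with convexD[OF assms this st] show "s *\<^sub>R x + t *\<^sub>R y \<in> {x \<in> S. F x < \<infinity>}"
      by (auto intro: le_less_trans)
  qed
qed

lemma quasiconvex_on_Max:
  assumes "finite U" and "U \<noteq> {}" and "\<And>u. u \<in> U \<Longrightarrow> quasiconvex_on S (F u)"
  shows "quasiconvex_on S (\<lambda>x. MAX u\<in>U. F u x)"
proof (rule quasiconvex_onI)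
  fix \<alpha> :: real
  have "{x \<in> S. (MAX u\<in>U. F u x) \<le> ereal \<alpha>} = (\<Inter>u\<in>U. {x \<in> S. F u x \<le> ereal \<alpha>})"
    using assms(1,2) by auto
  with assms(3) show "convex {x \<in> S. (MAX u\<in>U. F u x) \<le> ereal \<alpha>}"
    by (simp add: quasiconvex_on_def convex_INT)
qed

lemma convex_linear_le_affine:
  fixes c d :: "'a::real_inner"
  shows "convex {x. c \<bullet> x - r \<le> \<alpha> * (d \<bullet> x - s)}"
proof -
  have "{x. c \<bullet> x - r \<le> \<alpha> * (d \<bullet> x - s)} = {x. (c - \<alpha> *\<^sub>R d) \<bullet> x \<le> r - \<alpha> * s}"
    by (auto simp: inner_diff_left algebra_simps)
  then show ?thesis
    by (simp add: convex_halfspace_le)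
qed

text \<open>
  The general principle behind the theorem: a nonnegative supremum of affine functions over a
  nonnegative affine function has sublevel sets that are intersections of half-spaces with the
  domain \<open>S\<close>, because multiplying out the denominator leaves one linear inequality per index \<open>w\<close>.
\<close>

lemma quasiconvex_on_quot:
  fixes c :: "'i \<Rightarrow> 'a::real_inner" and d :: 'a
  assumes "convex S" and "0 \<le> z"
    and "\<And>x. x \<in> S \<Longrightarrow> 0 \<le> p x" and "\<And>x. x \<in> S \<Longrightarrow> 0 \<le> d \<bullet> x - s"
    and p: "\<And>x. x \<in> S \<Longrightarrow> p x = (SUP w\<in>W. ereal (c w \<bullet> x - r w))"
  shows "quasiconvex_on S (\<lambda>x. quot z (p x) (ereal (d \<bullet> x - s)))"
proof (rule quasiconvex_onI)
  fix \<alpha> :: real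
  have "{x \<in> S. quot z (p x) (ereal (d \<bullet> x - s)) \<le> ereal \<alpha>}
      = S \<inter> (\<Inter>w\<in>W. {x. c w \<bullet> x - r w \<le> \<alpha> * (d \<bullet> x - s)})
          \<inter> {x. s < d \<bullet> x \<or> z \<le> ereal \<alpha>}"
    using assms by (auto simp: quot_le_iff p SUP_le_iff)
  moreover have "convex {x. s < d \<bullet> x \<or> z \<le> ereal \<alpha>}"
    by (cases "z \<le> ereal \<alpha>") (simp_all add: convex_halfspace_gt)
  ultimately show "convex {x \<in> S. quot z (p x) (ereal (d \<bullet> x - s)) \<le> ereal \<alpha>}"
    using assms(1) by (simp add: convex_Int convex_INT convex_linear_le_affine)
qed

section \<open>The weight optimization problem\<close>

lemma weights_finite_convex_constraints:
  "\<exists>H. finite H \<and> (\<forall>h\<in>H. convex_on UNIV h)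
     \<and> {a :: real ^ 'n::finite. 1 \<le> a} = {a. \<forall>h\<in>H. h a \<le> (0::real)}"
proof (intro exI conjI)
  let ?H = "range (\<lambda>n (a :: real ^ 'n). 1 - a $ n)"
  show "\<forall>h\<in>?H. convex_on UNIV h"
    by (auto intro!: convex_onI simp: algebra_simps)
  show "{a :: real ^ 'n. 1 \<le> a} = {a. \<forall>h\<in>?H. h a \<le> (0::real)}"
    by (auto simp: less_eq_vec_def)
qed simp

lemma convex_weights: "convex {a :: real ^ 'n::finite. 1 \<le> a}"
proof -
  have "{a :: real ^ 'n. 1 \<le> a} = (\<Inter>n. {a. axis n 1 \<bullet> a \<ge> 1})"
    by (auto simp: less_eq_vec_def inner_axis')
  then show ?thesis
    by (simp add: convex_INT convex_halfspace_ge)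
qed

theorem theorem7p4:
  fixes g :: "'n::finite \<Rightarrow> real ^ 'd \<Rightarrow> real"
    and U :: "(real ^ 'd) set"
    and T :: nat
    and z :: ereal
  assumes "T > 0"
    and "\<And>n u. u \<in> orthant \<Longrightarrow> 0 \<le> g n u"
    and "\<And>n. F1 (g n)" and "\<And>n. F2 (g n)" and "\<And>n. F3 (g n)" and "\<And>n. F4 (g n)"
    and "finite U" and "U \<noteq> {}" and "U \<subseteq> {u. 0 \<le> u \<and> u \<le> (real T - 1) *\<^sub>R 1}"
    and "0 \<le> z"
  shows "quasiconvex_problem {a :: real ^ 'n. 1 \<le> a} (objective z g U)"
proof -
  define f where "f u = (\<Sum>n\<in>UNIV. g n u)" for u
  have "quasiconvex_on {a. 1 \<le> a}
      (\<lambda>a. quot z (conjugate f (grad (wsum g a) (u + 1))) (ereal (wsum g a u - f u)))"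
    if "u \<in> U" for u
  proof -
    from that assms(9) have u: "u \<in> orthant"
      by (auto simp: orthant_def)
    \<comment> \<open>The vectors of coefficients of \<open>a\<close> in the denominator and in the affine pieces of the numerator.\<close>
    define d :: "real ^ 'n" where "d = (\<chi> n. g n u)"
    define c :: "real ^ 'd \<Rightarrow> real ^ 'n" where "c w = (\<chi> n. grad (g n) (u + 1) \<bullet> w)" for w
    have d: "wsum g a u = d \<bullet> a" for a
      by (simp add: wsum_def d_def inner_vec_def mult.commute)
    have "quasiconvex_on {a. 1 \<le> a}
        (\<lambda>a. quot z (conjugate f (grad (wsum g a) (u + 1))) (ereal (d \<bullet> a - f u)))"
    proof (rule quasiconvex_on_quot[OF convex_weights \<open>0 \<le> z\<close>])
      fix a :: "real ^ 'n" assume "a \<in> {a. 1 \<le> a}"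
      then have "g n u \<le> a $ n * g n u" for n
        using assms(2)[OF u, of n] by (auto simp: less_eq_vec_def mult_le_cancel_right1)
      then have "f u \<le> wsum g a u"
        unfolding f_def wsum_def by (rule sum_mono)
      then show "0 \<le> d \<bullet> a - f u"
        by (simp add: d)
      show "0 \<le> conjugate f (grad (wsum g a) (u + 1))"
        using assms(6) by (simp add: conjugate_nonneg f_def F4_def)
      show "conjugate f (grad (wsum g a) (u + 1)) = (SUP w\<in>orthant. ereal (c w \<bullet> a - f w))"
        using grad_wsum[of g, OF assms(3) orthant_shift_in_interior[OF u]]
        by (simp add: conjugate_def c_def inner_vec_def[of _ a] inner_sum_left mult.commute)
    qed
    then show ?thesis
      by (simp add: d)
  qed
  from quasiconvex_on_Max[OF assms(7,8) this]
  have "quasiconvex_on {a. 1 \<le> a} (objective z g U)"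
    by (simp add: objective_def[abs_def] f_def[abs_def] Let_def)
  then show ?thesis
    unfolding quasiconvex_problem_def using weights_finite_convex_constraints by blast
qed

end
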